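(* Let $a>0$ be a real number. The set of infinite sequences $\varepsilon\in\{+,-\}^{\mathbb{N}^*}$ for which the sequence $(u_{n,\varepsilon})_n$ does not converge in $\overline{\mathbb{R}}$ (i.e. such that $\varepsilon$ does not represent any element of $\overline{\mathbb{R}}$) is at most countable. Consequently, the set of representable elements of $\overline{\mathbb{R}}$ is not empty.
   Context: $\overline{\mathbb{R}}=[-\infty,+\infty]$ is the extended real line with its usual order topology; convergence is in $\overline{\mathbb{R}}$ (infinite limits allowed). For a fixed real $a>0$ define $f_+,f_-:\overline{\mathbb{R}}\to\overline{\mathbb{R}}$ by $f_+(x)=e^{ax}$ and $f_-(x)=-e^{ax}$, with $e^{-\infty}=0$, $e^{+\infty}=+\infty$. For an infinite sequence $\varepsilon=(\varepsilon_1,\varepsilon_2,\ldots)$ of signs $+$ and $-$ and $n\ge 0$, put $f_{n,\varepsilon}=f_{\varepsilon_1}\circ f_{\varepsilon_2}\circ\cdots\circ f_{\varepsilon_n}$ ($f_{0,\varepsilon}$ is the identity) and $u_{n,\varepsilon}=f_{n,\varepsilon}(1)$. The sequence $\varepsilon$ represents $t\in\overline{\mathbb{R}}$ if $u_{n,\varepsilon}\to t$ in $\overline{\mathbb{R}}$ as $n\to\infty$; $t\in\overline{\mathbb{R}}$ is representable if some $\varepsilon$ represents it. *)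

theory Defs
  imports "HOL-Analysis.Analysis"
begin

function ereal_exp :: "ereal \<Rightarrow> ereal" where
  "ereal_exp (ereal r) = ereal (exp r)"
| "ereal_exp \<infinity> = \<infinity>"
| "ereal_exp (-\<infinity>) = 0"
  using ereal_cases by auto
termination by standard auto

datatype pm_sign = Plus_sign | Minus_sign

fun f_sign :: "real \<Rightarrow> pm_sign \<Rightarrow> ereal \<Rightarrow> ereal" where
  "f_sign a Plus_sign x = ereal_exp (ereal a * x)"
| "f_sign a Minus_sign x = - ereal_exp (ereal a * x)"

text \<open>
  A sign sequence \<open>(\<epsilon>\<^sub>1, \<epsilon>\<^sub>2, \<dots>)\<close> is encoded from index \<open>0\<close>: \<open>\<epsilon> k\<close> is the \<open>(k + 1)\<close>-st sign.
  New maps are composed on the inside, so \<open>f_comp a \<epsilon> n\<close> applies the \<open>n\<close>-th sign first and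
  the first sign last.
\<close>

primrec f_comp :: "real \<Rightarrow> (nat \<Rightarrow> pm_sign) \<Rightarrow> nat \<Rightarrow> ereal \<Rightarrow> ereal" where
  "f_comp a \<epsilon> 0 = id"
| "f_comp a \<epsilon> (Suc n) = f_comp a \<epsilon> n \<circ> f_sign a (\<epsilon> n)"

definition u_seq :: "real \<Rightarrow> (nat \<Rightarrow> pm_sign) \<Rightarrow> nat \<Rightarrow> ereal" where
  "u_seq a \<epsilon> n = f_comp a \<epsilon> n 1"

definition represents :: "real \<Rightarrow> (nat \<Rightarrow> pm_sign) \<Rightarrow> ereal \<Rightarrow> bool" where
  "represents a \<epsilon> t \<longleftrightarrow> u_seq a \<epsilon> \<longlonglongrightarrow> t"

definition representable :: "real \<Rightarrow> ereal \<Rightarrow> bool" where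
  "representable a t \<longleftrightarrow> (\<exists>\<epsilon>. represents a \<epsilon> t)"

end

theory Submission
  imports Defs
begin

text \<open>
  If two sign sequences first differ at index \<open>n\<close>, they share the monotone or antitone map
  \<open>f_comp a \<epsilon> n\<close>, whose value at \<open>0\<close> separates the later terms of the two sequences.
  Hence the open intervals between limit inferior and limit superior are pairwise disjoint, and only
  countably many of them can be nonempty. Existence follows because there are uncountably many
  sign sequences.
\<close>

lemma ereal_exp_nonneg: "0 \<le> ereal_exp x"
  by (cases x) auto

lemma mono_ereal_exp: "mono ereal_exp"
proof
  fix x y :: ereal
  assume "x \<le> y"
  then show "ereal_exp x \<le> ereal_exp y"
    by (cases x; cases y) auto
qed

lemma f_sign_mono_or_antimono:
  assumes "a > 0"
  shows "mono (f_sign a s) \<or> antimono (f_sign a s)"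
proof -
  have "mono (\<lambda>x. ereal_exp (ereal a * x))"
    using assms by (intro monoI monoD[OF mono_ereal_exp] ereal_mult_left_mono) auto
  then show ?thesis
    by (cases s) (auto simp: monotone_def)
qed

text \<open>Maps that are monotone or antitone are closed under composition. Which case occurs
  depends on the parity of the number of \<open>Minus_sign\<close> among the first \<open>n\<close>
  signs; the disjunction leaves this open.\<close>

lemma f_comp_mono_or_antimono:
  assumes "a > 0"
  shows "mono (f_comp a \<epsilon> n) \<or> antimono (f_comp a \<epsilon> n)"
proof (induction n)
  case 0
  then show ?case by (simp add: monotone_def)
next
  case (Suc n)
  then show ?case
    using f_sign_mono_or_antimono[OF assms, of "\<epsilon> n"] by (auto simp: monotone_def)
qed

lemma f_comp_cong:
  assumes "\<And>k. k < n \<Longrightarrow> \<epsilon> k = \<delta> k"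
  shows "f_comp a \<epsilon> n = f_comp a \<delta> n"
  using assms by (induction n) auto

text \<open>Since new maps go on the inside, everything after index \<open>n\<close> acts before
  \<open>f_sign a (\<epsilon> n)\<close> and is absorbed into the unknown point \<open>x\<close>.
  What remains visible is the sign at \<open>n\<close>, which decides on which side of 0 the
  argument of the prefix lies.\<close>

lemma f_comp_factor:
  assumes "n < m"
  shows "\<exists>x. f_comp a \<epsilon> m y = f_comp a \<epsilon> n (f_sign a (\<epsilon> n) x)"
  using assms
proof (induction m arbitrary: y)
  case 0
  then show ?case by simp
next
  case (Suc m)
  then show ?case by (cases "n = m") auto
qed

lemma limsup_le_liminf_if_separated:
  fixes u v :: "nat \<Rightarrow> 'a::complete_linorder"
  assumes "\<And>m. n < m \<Longrightarrow> u m \<le> c" and "\<And>m. n < m \<Longrightarrow> c \<le> v m"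
  shows "limsup u \<le> liminf v"
proof -
  have "limsup u \<le> c"
    using assms(1) by (intro Limsup_bounded eventually_sequentiallyI[of "Suc n"]) simp
  also have "c \<le> liminf v"
    using assms(2) by (intro Liminf_bounded eventually_sequentiallyI[of "Suc n"]) simp
  finally show ?thesis .
qed

lemma limsup_u_seq_le_liminf_of_first_diff:
  assumes "a > 0" and "\<epsilon> n = Plus_sign" and "\<delta> n = Minus_sign"
    and "\<And>k. k < n \<Longrightarrow> \<epsilon> k = \<delta> k"
  shows "limsup (u_seq a \<epsilon>) \<le> liminf (u_seq a \<delta>) \<or> limsup (u_seq a \<delta>) \<le> liminf (u_seq a \<epsilon>)"
proof -
  define F where "F = f_comp a \<epsilon> n"
  have F_\<delta>: "f_comp a \<delta> n = F"
    unfolding F_def using f_comp_cong[of n \<epsilon> \<delta>] assms(4) by simp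
  \<comment> \<open>Only the terms with \<open>n < m\<close> involve the sign at index
    \<open>n\<close>; limsup and liminf ignore the finitely many others.\<close>
  have pos: "\<exists>x\<ge>0. u_seq a \<epsilon> m = F x" if less: "n < m" for m
  proof -
    obtain x where "u_seq a \<epsilon> m = F (ereal_exp (ereal a * x))"
      using f_comp_factor[OF less, of a \<epsilon> 1] assms(2) by (auto simp: u_seq_def F_def)
    then show ?thesis
      using ereal_exp_nonneg by blast
  qed
  have neg: "\<exists>x\<le>0. u_seq a \<delta> m = F x" if less: "n < m" for m
  proof -
    obtain x where "u_seq a \<delta> m = F (- ereal_exp (ereal a * x))"
      using f_comp_factor[OF less, of a \<delta> 1] assms(3) by (auto simp: u_seq_def F_\<delta>)
    moreover have "- ereal_exp (ereal a * x) \<le> 0"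
      using ereal_exp_nonneg by simp
    ultimately show ?thesis by blast
  qed
  consider "mono F" | "antimono F"
    using f_comp_mono_or_antimono[OF assms(1)] unfolding F_def by blast
  then show ?thesis
  proof cases
    case 1
    then have "F 0 \<le> u_seq a \<epsilon> m" "u_seq a \<delta> m \<le> F 0" if "n < m" for m
      using pos[OF that] neg[OF that] by (metis monoD)+
    then have "limsup (u_seq a \<delta>) \<le> liminf (u_seq a \<epsilon>)"
      by (rule limsup_le_liminf_if_separated[rotated])
    then show ?thesis ..
  next
    case 2
    then have "u_seq a \<epsilon> m \<le> F 0" "F 0 \<le> u_seq a \<delta> m" if "n < m" for m
      using pos[OF that] neg[OF that] by (metis antimonoD)+
    then have "limsup (u_seq a \<epsilon>) \<le> liminf (u_seq a \<delta>)"
      by (rule limsup_le_liminf_if_separated)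
    then show ?thesis ..
  qed
qed

text \<open>The least index of disagreement reduces this to the previous lemma; the conclusion is
  symmetric, so either sequence may carry the \<open>Plus_sign\<close> there.\<close>

lemma limsup_u_seq_le_liminf_of_ne:
  assumes "a > 0" and "\<epsilon> \<noteq> \<delta>"
  shows "limsup (u_seq a \<epsilon>) \<le> liminf (u_seq a \<delta>) \<or> limsup (u_seq a \<delta>) \<le> liminf (u_seq a \<epsilon>)"
proof -
  have "\<exists>k. \<epsilon> k \<noteq> \<delta> k"
    using assms(2) by auto
  then obtain n where diff: "\<epsilon> n \<noteq> \<delta> n" and same: "\<And>k. k < n \<Longrightarrow> \<epsilon> k = \<delta> k"
    using exists_least_iff[of "\<lambda>k. \<epsilon> k \<noteq> \<delta> k"] by auto
  from diff consider "\<epsilon> n = Plus_sign" "\<delta> n = Minus_sign" | "\<delta> n = Plus_sign" "\<epsilon> n = Minus_sign"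
    by (cases "\<epsilon> n"; cases "\<delta> n") auto
  then show ?thesis
  proof cases
    case 1
    then show ?thesis
      using same by (rule limsup_u_seq_le_liminf_of_first_diff[OF assms(1)])
  next
    case 2
    then show ?thesis
      using limsup_u_seq_le_liminf_of_first_diff[OF assms(1), of \<delta> n \<epsilon>] same by auto
  qed
qed

lemma countable_not_convergent_u_seq:
  assumes "a > 0"
  shows "countable {\<epsilon>. \<not> convergent (u_seq a \<epsilon>)}"
proof -
  let ?N = "{\<epsilon>. \<not> convergent (u_seq a \<epsilon>)}"
  have "\<exists>r. liminf (u_seq a \<epsilon>) < ereal (real_of_rat r) \<and> ereal (real_of_rat r) < limsup (u_seq a \<epsilon>)"
    if "\<epsilon> \<in> ?N" for \<epsilon>
  proof -
    \<comment> \<open>In \<open>ereal\<close>, where infinite limits are allowed, convergence is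
      equality of liminf and limsup, so divergence leaves a gap, in which a rational can be
      chosen.\<close>
    have "liminf (u_seq a \<epsilon>) < limsup (u_seq a \<epsilon>)"
      using that Liminf_le_Limsup[of sequentially "u_seq a \<epsilon>"]
      by (auto simp: convergent_ereal less_le)
    then show ?thesis
      using ereal_dense3 by blast
  qed
  then obtain q where q: "\<And>\<epsilon>. \<epsilon> \<in> ?N \<Longrightarrow>
      liminf (u_seq a \<epsilon>) < ereal (real_of_rat (q \<epsilon>)) \<and> ereal (real_of_rat (q \<epsilon>)) < limsup (u_seq a \<epsilon>)"
    by metis
  \<comment> \<open>A rational \<open>r\<close> shared by two distinct sequences would lie below the
    limsup of one, which is at most the liminf of the other, which is below
    \<open>r\<close>.\<close>
  have "inj_on q ?N"
  proof (rule inj_onI, rule ccontr)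
    fix \<epsilon> \<delta>
    assume "\<epsilon> \<in> ?N" "\<delta> \<in> ?N" "q \<epsilon> = q \<delta>" "\<epsilon> \<noteq> \<delta>"
    then show False
      using q[of \<epsilon>] q[of \<delta>] limsup_u_seq_le_liminf_of_ne[OF assms, of \<epsilon> \<delta>] by auto
  qed
  then show ?thesis
    by (rule countableI')
qed

text \<open>Cantor's diagonal argument: flipping the \<open>k\<close>-th sign of the
  \<open>k\<close>-th listed sequence gives one missing from the list.\<close>

lemma uncountable_sign_sequences: "uncountable (UNIV :: (nat \<Rightarrow> pm_sign) set)"
proof
  assume "countable (UNIV :: (nat \<Rightarrow> pm_sign) set)"
  then obtain e :: "nat \<Rightarrow> nat \<Rightarrow> pm_sign" where e: "range e = UNIV"
    using uncountable_def by blast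
  define d where "d k = (if e k k = Plus_sign then Minus_sign else Plus_sign)" for k
  obtain k where "e k = d"
    using e by (metis rangeE UNIV_I)
  then have "e k k = d k" by simp
  then show False
    by (auto simp: d_def split: if_splits)
qed

theorem proposition1:
  fixes a :: real
  assumes "a > 0"
  shows "countable {\<epsilon> :: nat \<Rightarrow> pm_sign. \<not> convergent (u_seq a \<epsilon>)} \<and>
         {t :: ereal. representable a t} \<noteq> {}"
proof
  show cnt: "countable {\<epsilon> :: nat \<Rightarrow> pm_sign. \<not> convergent (u_seq a \<epsilon>)}"
    using assms by (rule countable_not_convergent_u_seq)
  \<comment> \<open>Some sign sequence thus lies outside the countable set, and it represents its
    own limit.\<close>
  have "{\<epsilon>. \<not> convergent (u_seq a \<epsilon>)} \<noteq> UNIV"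
    using cnt uncountable_sign_sequences by metis
  then show "{t :: ereal. representable a t} \<noteq> {}"
    by (auto simp: representable_def represents_def convergent_def)
qed

end
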